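(* Let $\Sigma=\{0,1\}$. For every set $\mathcal{F}\subseteq\Sigma^\infty$, $$\dim(\mathcal{F})=\inf \mathcal{G}_{prod}(\mathcal{F}),$$ where $\dim$ denotes Hausdorff dimension and $\mathcal{G}_{prod}(\mathcal{F})$ is the set of all $s\in[0,\infty)$ such that, for some integer $k\ge 1$, there is a $k$-product $s$-gale $d$ with $\mathcal{F}\subseteq S^\infty[d]$.
   Context: $\Sigma=\{0,1\}$; $\Sigma^*$ is the set of finite strings (including the empty string $\lambda$), $\Sigma^\infty$ the set of infinite sequences. For $w\in\Sigma^*$, $|w|$ is its length and $C_w\subseteq\Sigma^\infty$ is the set of infinite sequences having $w$ as a prefix. $X\restriction n$ is the string of the first $n$ symbols of $X\in\Sigma^\infty$. Hausdorff dimension: for $\mathcal{F}\subseteq\Sigma^\infty$ and $\delta>0$, a collection $\{w_i\}_{i\in\mathbb{N}}$ of strings in $\Sigma^*$ is a $\delta$-cover of $\mathcal{F}$ if $2^{-|w_i|}\le\delta$ for all $i$ and $\mathcal{F}\subseteq\bigcup_i C_{w_i}$. Put $\mathcal{H}^s_\delta(\mathcal{F})=\inf\{\sum_i 2^{-s|w_i|} : \{w_i\}_{i\in\mathbb{N}}\text{ is a }\delta\text{-cover of }\mathcal{F}\}$, $\mathcal{H}^s(\mathcal{F})=\lim_{\delta\to0}\mathcal{H}^s_\delta(\mathcal{F})$ and $\dim(\mathcal{F})=\inf\{s\ge0:\mathcal{H}^s(\mathcal{F})=0\}$. For $s\in[0,\infty)$, an $s$-gale is a function $d:\{0,1\}^*\to[0,\infty)$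 with $d(w)=2^{-s}[d(w0)+d(w1)]$ for all $w\in\{0,1\}^*$. For an integer $k\ge1$, a function $d:\{0,1\}^*\to[0,\infty)$ is a $k$-product $s$-gale if there are $s$-gales $d_1,\dots,d_k$ such that $d(w)=d_1(w)d_2(w)\cdots d_k(w)$ for all $w$. A $k$-product $s$-gale $d$ succeeds on $X\in\Sigma^\infty$ if $\limsup_{n\to\infty}d(X\restriction n)=\infty$, and $S^\infty[d]$ is the set of all $X\in\Sigma^\infty$ on which $d$ succeeds. *)

theory Defs
  imports "HOL-Library.Extended_Nonnegative_Real"
begin

type_synonym bitstring = "bool list"
type_synonym bitseq = "nat \<Rightarrow> bool"

definition restrict_seq :: "bitseq \<Rightarrow> nat \<Rightarrow> bitstring" where
  "restrict_seq X n = map X [0..<n]"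

definition cylinder :: "bitstring \<Rightarrow> bitseq set" where
  "cylinder w = {X. restrict_seq X (length w) = w}"

definition delta_cover :: "real \<Rightarrow> bitseq set \<Rightarrow> (nat \<Rightarrow> bitstring) \<Rightarrow> bool" where
  "delta_cover \<delta> F w \<longleftrightarrow>
     (\<forall>i. 2 powr (- real (length (w i))) \<le> \<delta>) \<and> F \<subseteq> (\<Union>i. cylinder (w i))"

definition hausdorff_pre :: "real \<Rightarrow> real \<Rightarrow> bitseq set \<Rightarrow> ennreal" where
  "hausdorff_pre s \<delta> F =
     Inf {(\<Sum>i. ennreal (2 powr (- s * real (length (w i))))) | w. delta_cover \<delta> F w}"

definition hausdorff_measure :: "real \<Rightarrow> bitseq set \<Rightarrow> ennreal" where
  "hausdorff_measure s F = Lim (at_right 0) (\<lambda>\<delta>. hausdorff_pre s \<delta> F)"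

lemma hausdorff_pre_antimono:
  assumes "\<delta> \<le> \<delta>'"
  shows "hausdorff_pre s \<delta>' F \<le> hausdorff_pre s \<delta> F"
  unfolding hausdorff_pre_def delta_cover_def
  using assms by (intro Inf_superset_mono) (blast intro: order_trans)

text \<open>The limit in the definition always exists, so it is never an unspecified value.\<close>

lemma hausdorff_measure_tendsto_SUP:
  "((\<lambda>\<delta>. hausdorff_pre s \<delta> F) \<longlongrightarrow> (SUP \<delta>\<in>{0<..}. hausdorff_pre s \<delta> F)) (at_right 0)"
proof (rule order_tendstoI)
  fix a assume "a < (SUP \<delta>\<in>{0<..}. hausdorff_pre s \<delta> F)"
  then obtain e where e: "0 < e" "a < hausdorff_pre s e F"
    by (auto simp: less_SUP_iff)
  have "a < hausdorff_pre s x F" if "x < e" for x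
    using e(2) hausdorff_pre_antimono[OF less_imp_le[OF that]] by (rule order_less_le_trans)
  with e(1) show "\<forall>\<^sub>F x in at_right 0. a < hausdorff_pre s x F"
    unfolding eventually_at_right_field by blast
next
  fix a assume a: "(SUP \<delta>\<in>{0<..}. hausdorff_pre s \<delta> F) < a"
  have "hausdorff_pre s x F < a" if "0 < x" for x
  proof -
    have "hausdorff_pre s x F \<le> (SUP \<delta>\<in>{0<..}. hausdorff_pre s \<delta> F)"
      using that by (intro SUP_upper) simp
    then show ?thesis
      using a by (rule order_le_less_trans)
  qed
  then show "\<forall>\<^sub>F x in at_right 0. hausdorff_pre s x F < a"
    unfolding eventually_at_right_field using zero_less_one by blast
qed

lemma hausdorff_measure_eq_SUP:
  "hausdorff_measure s F = (SUP \<delta>\<in>{0<..}. hausdorff_pre s \<delta> F)"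
  unfolding hausdorff_measure_def
  by (rule tendsto_Lim[OF _ hausdorff_measure_tendsto_SUP]) simp

text \<open>
  This set is nonempty for every F, since every s > 1 belongs to it; so the real-valued
  infimum is the genuine one.
\<close>

definition hausdorff_dim :: "bitseq set \<Rightarrow> real" where
  "hausdorff_dim F = Inf {s. 0 \<le> s \<and> hausdorff_measure s F = 0}"

definition gale :: "real \<Rightarrow> (bitstring \<Rightarrow> real) \<Rightarrow> bool" where
  "gale s d \<longleftrightarrow>
     (\<forall>w. 0 \<le> d w) \<and>
     (\<forall>w. d w = 2 powr (- s) * (d (w @ [False]) + d (w @ [True])))"

definition product_gale :: "nat \<Rightarrow> real \<Rightarrow> (bitstring \<Rightarrow> real) \<Rightarrow> bool" where
  "product_gale k s d \<longleftrightarrow>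
     (\<exists>ds :: nat \<Rightarrow> bitstring \<Rightarrow> real.
        (\<forall>i\<in>{1..k}. gale s (ds i)) \<and> (\<forall>w. d w = (\<Prod>i\<in>{1..k}. ds i w)))"

definition success_set :: "(bitstring \<Rightarrow> real) \<Rightarrow> bitseq set" where
  "success_set d = {X. limsup (\<lambda>n. ereal (d (restrict_seq X n))) = \<infinity>}"

text \<open>
  This set is likewise nonempty: for s > 1, the s-gale that maps w to 2 powr ((s - 1) * |w|)
  succeeds on every sequence.
\<close>

definition prod_gale_rates :: "bitseq set \<Rightarrow> real set" where
  "prod_gale_rates F =
     {s. 0 \<le> s \<and> (\<exists>k\<ge>1. \<exists>d. product_gale k s d \<and> F \<subseteq> success_set d)}"

end

theory Submission
  imports Defs
begin

text \<open>
  If a product of gales is unbounded along a sequence then so is the sum of its factors, which is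
  again a gale; hence products succeed on no more than single gales do, and the claim reduces to
  Lutz's gale characterization of Hausdorff dimension. A gale yields covers by the minimal strings
  on which it exceeds a large constant, controlled by a Kraft inequality. Conversely, covers of
  weight at most \<open>1/4^n\<close> yield a gale, namely the sum over \<open>n\<close> of \<open>2^n\<close> times
  the gales that bet on reaching the strings of the \<open>n\<close>-th cover.
\<close>

section \<open>Success of gales as unboundedness\<close>

lemma restrict_seq_simps [simp]:
  "length (restrict_seq X n) = n"
  "m \<le> n \<Longrightarrow> take m (restrict_seq X n) = restrict_seq X m"
  by (auto simp: restrict_seq_def take_map)

text \<open>The first \<open>m\<close> values are bounded, by \<open>b\<close> below, so a value
  above \<open>b + 1\<close> can only occur at an index at least \<open>m\<close>; unboundedness
  therefore persists on every tail, which is what the limsup measures.\<close>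

lemma success_set_iff_unbounded:
  "X \<in> success_set d \<longleftrightarrow> (\<forall>c. \<exists>n. c \<le> d (restrict_seq X n))"
proof
  assume "X \<in> success_set d"
  then have lim: "limsup (\<lambda>n. ereal (d (restrict_seq X n))) = \<infinity>"
    by (simp add: success_set_def)
  show "\<forall>c. \<exists>n. c \<le> d (restrict_seq X n)"
  proof (rule ccontr)
    assume "\<not> ?thesis"
    then obtain c where "\<And>n. d (restrict_seq X n) \<le> c"
      by (auto simp: not_le intro: less_imp_le)
    then have "limsup (\<lambda>n. ereal (d (restrict_seq X n))) \<le> ereal c"
      by (intro Limsup_bounded) auto
    with lim show False by simp
  qed
next
  assume unb: "\<forall>c. \<exists>n. c \<le> d (restrict_seq X n)"
  have "ereal c \<le> limsup (\<lambda>n. ereal (d (restrict_seq X n)))" for c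
    unfolding limsup_INF_SUP
  proof (rule INF_greatest)
    fix m
    define b where "b = (\<Sum>n<m. \<bar>d (restrict_seq X n)\<bar>)"
    have b: "d (restrict_seq X n) \<le> b" if "n < m" for n
      using that member_le_sum[of n "{..<m}" "\<lambda>n. \<bar>d (restrict_seq X n)\<bar>"]
      by (auto simp: b_def)
    obtain n where n: "max c (b + 1) \<le> d (restrict_seq X n)"
      using unb by blast
    with b[of n] have "m \<le> n" by (cases "n < m") auto
    then show "ereal c \<le> (SUP n\<in>{m..}. ereal (d (restrict_seq X n)))"
      using n by (intro SUP_upper2[of n]) auto
  qed
  then have "limsup (\<lambda>n. ereal (d (restrict_seq X n))) = \<infinity>"
    by (metis ereal_top)
  then show "X \<in> success_set d"
    by (simp add: success_set_def)
qed

section \<open>Reduction of products of gales to single gales\<close>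

lemma gale_nonneg: "gale s d \<Longrightarrow> 0 \<le> d w"
  unfolding gale_def by blast

lemma gale_split: "gale s d \<Longrightarrow> d w = 2 powr (- s) * (d (w @ [False]) + d (w @ [True]))"
  unfolding gale_def by blast

lemma gale_sum:
  assumes "\<And>i. i \<in> I \<Longrightarrow> gale s (d i)"
  shows "gale s (\<lambda>w. \<Sum>i\<in>I. d i w)"
proof -
  have "(\<Sum>i\<in>I. d i w) =
      2 powr (- s) * ((\<Sum>i\<in>I. d i (w @ [False])) + (\<Sum>i\<in>I. d i (w @ [True])))" for w
    unfolding sum.distrib[symmetric] sum_distrib_left
    using assms by (intro sum.cong refl gale_split)
  moreover have "0 \<le> (\<Sum>i\<in>I. d i w)" for w
    using assms by (intro sum_nonneg gale_nonneg)
  ultimately show ?thesis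
    unfolding gale_def by blast
qed

text \<open>Each nonnegative factor is at most the sum. The bound is crude, but it keeps
  unboundedness, as the exponent does not vary along the sequence.\<close>

lemma prod_le_sum_power:
  fixes f :: "'a \<Rightarrow> real"
  assumes "finite I" "\<And>i. i \<in> I \<Longrightarrow> 0 \<le> f i"
  shows "(\<Prod>i\<in>I. f i) \<le> (\<Sum>i\<in>I. f i) ^ card I"
proof -
  have "(\<Prod>i\<in>I. f i) \<le> (\<Prod>i\<in>I. \<Sum>i\<in>I. f i)"
    using assms by (intro prod_mono conjI member_le_sum) auto
  then show ?thesis by simp
qed

lemma product_gale_imp_gale:
  assumes "product_gale k s d"
  shows "\<exists>d'. gale s d' \<and> success_set d \<subseteq> success_set d'"
proof -
  obtain ds where ds: "\<And>i. i \<in> {1..k} \<Longrightarrow> gale s (ds i)" "\<And>w. d w = (\<Prod>i\<in>{1..k}. ds i w)"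
    using assms unfolding product_gale_def by blast
  define d' where "d' w = (\<Sum>i\<in>{1..k}. ds i w)" for w
  have d': "gale s d'"
    unfolding d'_def using ds(1) by (rule gale_sum)
  have le: "d w \<le> d' w ^ k" for w
    using prod_le_sum_power[of "{1..k}" "\<lambda>i. ds i w"] ds(1)
    by (auto simp: ds(2) d'_def intro: gale_nonneg)
  have "X \<in> success_set d'" if X: "X \<in> success_set d" for X
    unfolding success_set_iff_unbounded
  proof
    fix c :: real
    \<comment> \<open>Taking k-th roots needs a strict inequality, hence the \<open>+ 1\<close>;
      \<open>max c 0\<close> makes the bound on \<open>d'\<close> cover negative \<open>c\<close> as
      well.\<close>
    obtain n where n: "max c 0 ^ k + 1 \<le> d (restrict_seq X n)"
      using X unfolding success_set_iff_unbounded by blast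
    have "max c 0 ^ k < d' (restrict_seq X n) ^ k"
      using n le[of "restrict_seq X n"] by linarith
    then have "max c 0 < d' (restrict_seq X n)"
      using gale_nonneg[OF d'] by (rule power_less_imp_less_base)
    then show "\<exists>n. c \<le> d' (restrict_seq X n)"
      by (intro exI[of _ n]) simp
  qed
  with d' show ?thesis by blast
qed

lemma product_gale_1: "gale s d \<Longrightarrow> product_gale 1 s d"
  unfolding product_gale_def by (intro exI[of _ "\<lambda>_. d"]) auto

lemma prod_gale_rates_eq:
  "prod_gale_rates F = {s. 0 \<le> s \<and> (\<exists>d. gale s d \<and> F \<subseteq> success_set d)}"
  unfolding prod_gale_rates_def
  using product_gale_imp_gale product_gale_1 by blast

section \<open>Covers from gales\<close>

text \<open>Scaled by \<open>2 powr (- s * length w)\<close>, a gale is an additive mass on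
  cylinders, and a prefix-free set has disjoint cylinders. The induction is on a length bound and
  splits \<open>A\<close> by first letter, so the root \<open>u\<close> has to be arbitrary.\<close>

lemma gale_Kraft:
  assumes "gale s d" "finite A" "\<And>v w. v \<in> A \<Longrightarrow> v @ w \<in> A \<Longrightarrow> w = []"
  shows "(\<Sum>w\<in>A. 2 powr (- s * length w) * d (u @ w)) \<le> d u"
proof -
  have d: "0 \<le> d w" "d w = 2 powr (- s) * (d (w @ [False]) + d (w @ [True]))" for w
    using gale_nonneg[OF assms(1)] gale_split[OF assms(1)] by blast+
  obtain N where "\<forall>w\<in>A. length w < N"
    using assms(2) finite_nat_set_iff_bounded[of "length ` A"] by auto
  then show ?thesis
    using assms(2,3)
  proof (induction N arbitrary: A u)
    case 0
    then have "A = {}" by auto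
    then show ?case by (simp add: d(1))
  next
    case (Suc N)
    show ?case
    proof (cases "[] \<in> A")
      case True
      with Suc.prems(3)[of "[]"] have "A = {[]}" by auto
      then show ?thesis by simp
    next
      case False
      define B where "B b = {w. b # w \<in> A}" for b
      have fin: "finite (B b)" for b
        using finite_vimageI[OF Suc.prems(2), of "(#) b"] by (simp add: B_def vimage_def)
      have le: "(\<Sum>w\<in>B b. 2 powr (- s * length w) * d ((u @ [b]) @ w)) \<le> d (u @ [b])" for b
        using Suc.prems(1,3) by (intro Suc.IH fin) (fastforce simp: B_def)+
      have A: "A = (#) False ` B False \<union> (#) True ` B True"
      proof (intro equalityI subsetI)
        fix w assume "w \<in> A"
        with False obtain b v where "w = b # v" "v \<in> B b"
          by (cases w) (auto simp: B_def)
        then show "w \<in> (#) False ` B False \<union> (#) True ` B True"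
          by (cases b) auto
      qed (auto simp: B_def)
      have part: "(\<Sum>w\<in>(#) b ` B b. 2 powr (- s * length w) * d (u @ w))
          \<le> 2 powr (- s) * d (u @ [b])" for b
      proof -
        have "2 powr (- (s * (1 + real n))) = 2 powr (- s) * 2 powr (- (s * real n))" for n
          by (simp add: powr_add[symmetric] distrib_left)
        then have "(\<Sum>w\<in>(#) b ` B b. 2 powr (- s * length w) * d (u @ w))
            = 2 powr (- s) * (\<Sum>w\<in>B b. 2 powr (- s * length w) * d ((u @ [b]) @ w))"
          by (simp add: sum.reindex sum_distrib_left mult.assoc)
        also have "\<dots> \<le> 2 powr (- s) * d (u @ [b])"
          by (intro mult_left_mono le) simp
        finally show ?thesis .
      qed
      have "(\<Sum>w\<in>A. 2 powr (- s * length w) * d (u @ w))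
          = (\<Sum>b\<in>UNIV. \<Sum>w\<in>(#) b ` B b. 2 powr (- s * length w) * d (u @ w))"
        unfolding A UNIV_bool by (subst sum.union_disjoint) (use fin in auto)
      also have "\<dots> \<le> 2 powr (- s) * d (u @ [False]) + 2 powr (- s) * d (u @ [True])"
        using part[of False] part[of True] by (simp add: UNIV_bool)
      also have "\<dots> = d u"
        using d(2)[of u] by (simp add: distrib_left)
      finally show ?thesis .
    qed
  qed
qed

text \<open>Removes the limit and the infimum, so that both directions of the gale characterization
  can work with explicit covers.\<close>

lemma hausdorff_measure_zero_iff:
  "hausdorff_measure s F = 0 \<longleftrightarrow>
    (\<forall>\<delta>>0. \<forall>e>0. \<exists>w. delta_cover \<delta> F w \<and>
      (\<Sum>i. ennreal (2 powr (- s * real (length (w i))))) < ennreal e)"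
proof -
  have pre: "hausdorff_pre s \<delta> F = 0 \<longleftrightarrow> (\<forall>e>0. hausdorff_pre s \<delta> F < ennreal e)" for \<delta>
  proof
    assume small: "\<forall>e>0. hausdorff_pre s \<delta> F < ennreal e"
    show "hausdorff_pre s \<delta> F = 0"
    proof (rule ccontr)
      assume "hausdorff_pre s \<delta> F \<noteq> 0"
      \<comment> \<open>If the premeasure is infinite, \<open>e = 1\<close> serves; otherwise its
        own real value does.\<close>
      then obtain e where "0 < e" "ennreal e \<le> hausdorff_pre s \<delta> F"
        by (cases "hausdorff_pre s \<delta> F") (force simp: less_le intro: that[of 1])+
      with small show False by (auto simp: not_le[symmetric])
    qed
  qed auto
  have "hausdorff_measure s F = 0 \<longleftrightarrow> (\<forall>\<delta>>0. hausdorff_pre s \<delta> F = 0)"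
    unfolding hausdorff_measure_eq_SUP bot_ennreal[symmetric] SUP_bot_conv by auto
  also have "\<dots> \<longleftrightarrow> (\<forall>\<delta>>0. \<forall>e>0. hausdorff_pre s \<delta> F < ennreal e)"
    by (simp add: pre)
  finally show ?thesis
    unfolding hausdorff_pre_def Inf_less_iff by blast
qed

text \<open>The minimal strings with value at least \<open>c\<close> are prefix-free, so by the
  Kraft inequality their weight is at most \<open>d [] / c\<close>. Positivity of \<open>t\<close>
  gives long strings arbitrarily small weight, as the padding of the cover requires.\<close>

lemma gale_success_imp_hausdorff_measure_zero:
  assumes d: "gale s d" and F: "F \<subseteq> success_set d" and t: "s \<le> t" "0 < t"
  shows "hausdorff_measure t F = 0"
  unfolding hausdorff_measure_zero_iff
proof (intro allI impI)
  fix \<delta> e :: real assume \<delta>: "0 < \<delta>" and e: "0 < e"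
  have d0: "0 \<le> d w" for w
    using d by (rule gale_nonneg)
  obtain N :: nat where N: "- log 2 \<delta> \<le> N"
    using real_arch_simple by blast
  have small: "2 powr (- real n) \<le> \<delta>" if "N \<le> n" for n
  proof -
    have "2 powr (- real n) \<le> 2 powr (log 2 \<delta>)"
      using N that by (intro powr_mono) auto
    then show ?thesis using \<delta> by simp
  qed
  define b where "b = Max (d ` {w. set w \<subseteq> UNIV \<and> length w \<le> N})"
  have b: "d w \<le> b" if "length w \<le> N" for w
    unfolding b_def using that finite_lists_length_le[of "UNIV :: bool set" N]
    by (intro Max_ge) auto
  \<comment> \<open>The first bound exceeds all values of \<open>d\<close> on strings of length at
    most \<open>N\<close>, so strings in \<open>A\<close> are long enough for a
    \<open>\<delta>\<close>-cover. The second makes their weight at most \<open>e / 3\<close>; its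
    \<open>+ 1\<close> keeps it positive when \<open>d []\<close> vanishes.\<close>
  define c where "c = max (b + 1) (3 * (d [] + 1) / e)"
  have c: "0 < c" "d [] / c \<le> e / 3" "b < c"
  proof -
    have "0 < 3 * (d [] + 1) / e"
      using e d0[of "[]"] by auto
    then show c0: "0 < c" by (simp add: c_def less_max_iff_disj)
    have "3 * (d [] + 1) / e \<le> c" by (simp add: c_def)
    then show "d [] / c \<le> e / 3"
      using e c0 by (simp add: field_simps)
    show "b < c" by (simp add: c_def)
  qed
  define A where "A = {w. c \<le> d w \<and> (\<forall>m<length w. d (take m w) < c)}"
  have A_prefix: "w = []" if "v \<in> A" "v @ w \<in> A" for v w
    using that by (cases w) (force simp: A_def dest: spec[of _ "length v"])+
  have A_long: "N < length w" if "w \<in> A" for w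
    using that b[of w] c(3) by (cases "length w \<le> N") (auto simp: A_def)
  have A_sum: "(\<Sum>w\<in>B. 2 powr (- t * length w)) \<le> e / 3" if B: "finite B" "B \<subseteq> A" for B
  proof -
    have mono: "2 powr (- t * real n) \<le> 2 powr (- s * real n)" for n
      using t by (intro powr_mono mult_right_mono) auto
    have "c * (\<Sum>w\<in>B. 2 powr (- t * length w)) = (\<Sum>w\<in>B. 2 powr (- t * length w) * c)"
      by (simp add: sum_distrib_left mult.commute)
    also have "\<dots> \<le> (\<Sum>w\<in>B. 2 powr (- s * length w) * d ([] @ w))"
      using B c(1) by (intro sum_mono mult_mono mono) (auto simp: A_def)
    also have "\<dots> \<le> d []"
      using B A_prefix by (intro gale_Kraft[OF d]) auto
    finally have "(\<Sum>w\<in>B. 2 powr (- t * length w)) \<le> d [] / c"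
      using c(1) by (simp only: pos_le_divide_eq mult.commute)
    also note c(2)
    finally show ?thesis .
  qed
  \<comment> \<open>Lengths for the padding strings: at least \<open>N\<close> for the sake of
    \<open>\<delta>\<close>, and with weights below a geometric series of sum
    \<open>e / 3\<close>.\<close>
  have "\<exists>n::nat. N \<le> n \<and> 2 powr (- t * n) \<le> e / 3 * (1 / 2) ^ Suc i" for i
  proof -
    obtain n :: nat where n: "max N (- log 2 (e / 3 * (1 / 2) ^ Suc i) / t) \<le> n"
      using real_arch_simple by blast
    have "2 powr (- t * n) \<le> 2 powr (log 2 (e / 3 * (1 / 2) ^ Suc i))"
      using n t by (intro powr_mono) (auto simp: field_simps)
    then show ?thesis
      using n e by (intro exI[of _ n]) auto
  qed
  then obtain L where L: "\<And>i. N \<le> L i" "\<And>i. 2 powr (- t * L i) \<le> e / 3 * (1 / 2) ^ Suc i"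
    by metis
  define I where "I = to_nat ` A"
  \<comment> \<open>Covers are infinite sequences, so the indices not used by \<open>A\<close> are filled
    with strings of negligible total weight.\<close>
  define w where "w i = (if i \<in> I then from_nat i else replicate (L i) False)" for i
  have "delta_cover \<delta> F w"
    unfolding delta_cover_def
  proof (intro conjI allI subsetI)
    show "2 powr (- real (length (w i))) \<le> \<delta>" for i
      using A_long L(1) by (intro small) (auto simp: w_def I_def intro: less_imp_le)
  next
    fix X assume "X \<in> F"
    with F have ex: "\<exists>n. c \<le> d (restrict_seq X n)"
      by (auto simp: success_set_iff_unbounded)
    define n where "n = (LEAST n. c \<le> d (restrict_seq X n))"
    have "c \<le> d (restrict_seq X n)"
      unfolding n_def using ex by (rule LeastI_ex)
    moreover have "d (restrict_seq X m) < c" if "m < n" for m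
      using not_less_Least[OF that[unfolded n_def]] by simp
    ultimately have "restrict_seq X n \<in> A"
      by (simp add: A_def)
    then have "w (to_nat (restrict_seq X n)) = restrict_seq X n"
      by (simp add: w_def I_def)
    then show "X \<in> (\<Union>i. cylinder (w i))"
      by (auto simp: cylinder_def intro!: exI[of _ "to_nat (restrict_seq X n)"])
  qed
  moreover have "(\<Sum>i. ennreal (2 powr (- t * length (w i)))) < ennreal e"
  proof -
    \<comment> \<open>One third of \<open>e\<close> pays for \<open>A\<close>, one for the padding;
      the last leaves room for strict inequality.\<close>
    have "(\<Sum>i<n. ennreal (2 powr (- t * length (w i)))) \<le> ennreal (2 * e / 3)" for n
    proof -
      have "(\<Sum>i<n. 2 powr (- t * length (w i))) =
          (\<Sum>i\<in>{..<n} \<inter> I. 2 powr (- t * length (w i))) +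
          (\<Sum>i\<in>{..<n} - I. 2 powr (- t * length (w i)))"
        by (subst sum.Int_Diff[of _ _ I]) auto
      \<comment> \<open>Decoding is injective on \<open>I\<close>, which turns this into a sum over
        a finite subset of \<open>A\<close>.\<close>
      also have "(\<Sum>i\<in>{..<n} \<inter> I. 2 powr (- t * length (w i))) =
          (\<Sum>v\<in>(from_nat ` ({..<n} \<inter> I) :: bitstring set). 2 powr (- t * length v))"
        by (subst sum.reindex) (auto simp: w_def I_def inj_on_def intro!: sum.cong)
      also have "\<dots> \<le> e / 3"
        by (intro A_sum) (auto simp: I_def)
      also have "(\<Sum>i\<in>{..<n} - I. 2 powr (- t * length (w i))) =
          (\<Sum>i\<in>{..<n} - I. 2 powr (- t * L i))"
        by (intro sum.cong) (auto simp: w_def)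
      also have "\<dots> \<le> (\<Sum>i\<in>{..<n} - I. e / 3 * (1 / 2) ^ Suc i)"
        by (intro sum_mono L)
      also have "\<dots> \<le> (\<Sum>i<n. e / 3 * (1 / 2) ^ Suc i)"
        using e by (intro sum_mono2) auto
      also have "\<dots> = e / 3 * (\<Sum>i<n. (1 / 2) ^ Suc i)"
        by (simp only: sum_distrib_left)
      also have "\<dots> \<le> e / 3 * 1"
        using e sum_le_suminf[of "\<lambda>i. (1 / 2 :: real) ^ Suc i" "{..<n}"] power_half_series
        by (intro mult_left_mono) (auto simp: sums_iff)
      finally show ?thesis
        by (subst sum_ennreal) (auto intro!: ennreal_leI)
    qed
    then have "(\<Sum>i. ennreal (2 powr (- t * length (w i)))) \<le> ennreal (2 * e / 3)"
      by (intro suminf_le_const) auto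
    also have "\<dots> < ennreal e"
      using e by (intro ennreal_lessI) auto
    finally show ?thesis .
  qed
  ultimately show "\<exists>w. delta_cover \<delta> F w \<and> (\<Sum>i. ennreal (2 powr (- t * length (w i)))) < ennreal e"
    by blast
qed

section \<open>Gales from covers\<close>

text \<open>The probability that a uniformly random extension of \<open>v\<close> passes through \<open>w\<close>;
  scaled by \<open>2 powr (s * |w|)\<close> it becomes an \<open>s\<close>-gale.\<close>

fun bet_weight :: "bitstring \<Rightarrow> bitstring \<Rightarrow> real" where
  "bet_weight [] w = (1 / 2) ^ length w"
| "bet_weight (a # v) [] = 1"
| "bet_weight (a # v) (b # w) = (if a = b then bet_weight v w else 0)"

lemma bet_weight_Nil [simp]: "bet_weight v [] = 1"
  by (cases v) auto

lemma bet_weight_self [simp]: "bet_weight v v = 1"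
  by (induction v) auto

lemma bet_weight_nonneg: "0 \<le> bet_weight v w"
  by (induction v w rule: bet_weight.induct) auto

lemma bet_weight_le_1: "bet_weight v w \<le> 1"
  by (induction v w rule: bet_weight.induct) (auto intro: power_le_one)

lemma bet_weight_snoc: "bet_weight v w = bet_weight v (w @ [False]) + bet_weight v (w @ [True])"
  by (induction v w rule: bet_weight.induct) auto

text \<open>The double series is formed in \<open>ennreal\<close>, where it always converges and may
  be rearranged. It is finite because the \<open>n\<close>-th block contributes at most
  \<open>2^n * (1/4)^n\<close>, up to a factor depending only on \<open>length w\<close>.\<close>

lemma hausdorff_measure_zero_imp_gale_success:
  assumes "hausdorff_measure s F = 0"
  shows "\<exists>d. gale s d \<and> F \<subseteq> success_set d"
proof -
  have "\<exists>w. delta_cover 1 F w \<and>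
      (\<Sum>i. ennreal (2 powr (- s * length (w i)))) < ennreal ((1 / 4) ^ n)" for n :: nat
    using assms unfolding hausdorff_measure_zero_iff by simp
  then obtain V where V: "\<And>n. delta_cover 1 F (V n)"
    "\<And>n. (\<Sum>i. ennreal (2 powr (- s * length (V n i)))) < ennreal ((1 / 4) ^ n)"
    by metis
  \<comment> \<open>The exponent is normalized so that the value at the target \<open>V n i\<close>
    is exactly \<open>2 ^ n\<close>.\<close>
  define g where "g n i w =
    ennreal (2 ^ n * (2 powr (s * (real (length w) - real (length (V n i)))) * bet_weight (V n i) w))"
    for n i w
  define D where "D w = (\<Sum>n. \<Sum>i. g n i w)" for w
  have g_split: "g n i w = ennreal (2 powr (- s)) * (g n i (w @ [False]) + g n i (w @ [True]))"
    for n i w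
  proof -
    define v where "v = V n i"
    define q where "q u = 2 ^ n * (2 powr (s * (real (length u) - real (length v))) * bet_weight v u)"
      for u
    have "2 powr (- s) * (q (w @ [False]) + q (w @ [True])) =
        2 ^ n * (2 powr (- s) * 2 powr (s * (real (length w) + 1 - real (length v))) *
          (bet_weight v (w @ [False]) + bet_weight v (w @ [True])))"
      by (simp add: q_def algebra_simps)
    also have "\<dots> = q w"
      by (simp add: q_def bet_weight_snoc[symmetric] powr_add[symmetric] algebra_simps)
    finally have "q w = 2 powr (- s) * (q (w @ [False]) + q (w @ [True]))" ..
    moreover have "0 \<le> q u" for u
      by (simp add: q_def bet_weight_nonneg)
    ultimately have "ennreal (q w) = ennreal (2 powr (- s)) *
        (ennreal (q (w @ [False])) + ennreal (q (w @ [True])))"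
      by (metis ennreal_mult ennreal_plus add_nonneg_nonneg powr_ge_zero)
    then show ?thesis
      by (simp only: g_def q_def v_def)
  qed
  have D_split: "D w = ennreal (2 powr (- s)) * (D (w @ [False]) + D (w @ [True]))" for w
  proof -
    have "D w = (\<Sum>n. \<Sum>i. ennreal (2 powr (- s)) * (g n i (w @ [False]) + g n i (w @ [True])))"
      unfolding D_def by (intro suminf_cong g_split)
    then show ?thesis
      by (simp add: D_def suminf_add[symmetric] summableI)
  qed
  have "g n i w \<le> ennreal (2 powr (s * length w)) *
      (ennreal (2 ^ n) * ennreal (2 powr (- s * length (V n i))))" for n i w
  proof -
    have "g n i w \<le> ennreal (2 ^ n * (2 powr (s * (real (length w) - real (length (V n i)))) * 1))"
      unfolding g_def by (intro ennreal_leI mult_left_mono bet_weight_le_1) auto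
    then show ?thesis
      by (simp add: ennreal_mult[symmetric] algebra_simps powr_diff powr_minus divide_inverse)
  qed
  then have "D w \<le> (\<Sum>n. \<Sum>i. ennreal (2 powr (s * length w)) *
      (ennreal (2 ^ n) * ennreal (2 powr (- s * length (V n i)))))" for w
    unfolding D_def by (intro suminf_le summableI)
  also have "(\<Sum>n. \<Sum>i. ennreal (2 powr (s * length w)) *
      (ennreal (2 ^ n) * ennreal (2 powr (- s * length (V n i))))) \<le>
      ennreal (2 powr (s * length w)) * (\<Sum>n. ennreal ((1 / 2) ^ n))" for w :: bitstring
  proof -
    have "ennreal (2 ^ n) * (\<Sum>i. ennreal (2 powr (- s * length (V n i)))) \<le> ennreal ((1 / 2) ^ n)" for n
    proof -
      have "ennreal (2 ^ n) * (\<Sum>i. ennreal (2 powr (- s * length (V n i))))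
          \<le> ennreal (2 ^ n) * ennreal ((1 / 4) ^ n)"
        by (intro mult_left_mono less_imp_le V) auto
      also have "\<dots> = ennreal ((1 / 2) ^ n)"
        by (simp add: ennreal_mult[symmetric] power_mult_distrib[symmetric])
      finally show ?thesis .
    qed
    then show ?thesis
      by (simp only: ennreal_suminf_cmult) (intro mult_left_mono suminf_le summableI, auto)
  qed
  also have "(\<Sum>n. ennreal ((1 / 2) ^ n)) = ennreal 2"
    by (subst suminf_ennreal_eq[of _ 2]) (use geometric_sums[of "1/2 :: real"] in auto)
  finally have D_fin: "D w < top" for w
    by (rule le_less_trans) (simp add: ennreal_mult_less_top)
  define d where "d w = enn2real (D w)" for w
  have "gale s d"
    unfolding gale_def
  proof (intro conjI allI)
    show "0 \<le> d w" for w
      by (simp add: d_def)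
    show "d w = 2 powr (- s) * (d (w @ [False]) + d (w @ [True]))" for w
      using D_fin[of "w @ [False]"] D_fin[of "w @ [True]"]
      unfolding d_def D_split[of w]
      by (cases "D (w @ [False])"; cases "D (w @ [True])")
        (simp_all add: ennreal_plus[symmetric] enn2real_mult del: ennreal_plus)
  qed
  moreover have "X \<in> success_set d" if X: "X \<in> F" for X
    unfolding success_set_iff_unbounded
  proof
    fix c :: real
    obtain n where n: "c < 2 ^ n"
      using real_arch_pow[of 2 c] by auto
    \<comment> \<open>Every cover contains a prefix of \<open>X\<close>, and at that prefix the
      single summand \<open>g n i\<close> already exceeds \<open>c\<close>.\<close>
    obtain i where i: "restrict_seq X (length (V n i)) = V n i"
      using V(1)[of n] X by (auto simp: delta_cover_def cylinder_def)
    have "ennreal (2 ^ n) = g n i (V n i)"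
      by (simp add: g_def)
    also have "\<dots> \<le> (\<Sum>j. g n j (V n i))"
      using sum_le_suminf[of "\<lambda>j. g n j (V n i)" "{i}"] by (simp add: summableI)
    also have "\<dots> \<le> D (V n i)"
      unfolding D_def using sum_le_suminf[of "\<lambda>m. \<Sum>j. g m j (V n i)" "{n}"] by simp
    finally have "2 ^ n \<le> d (V n i)"
      unfolding d_def using D_fin by (metis enn2real_mono enn2real_ennreal zero_le_numeral zero_le_power)
    with n i show "\<exists>n. c \<le> d (restrict_seq X n)"
      by (intro exI[of _ "length (V n i)"]) simp
  qed
  ultimately show ?thesis by blast
qed

theorem theorem2:
  fixes F :: "(nat \<Rightarrow> bool) set"
  shows "hausdorff_dim F = Inf (prod_gale_rates F)"
proof -
  define A where "A = {s. 0 \<le> s \<and> hausdorff_measure s F = 0}"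
  define G where "G = prod_gale_rates F"
  have sub: "A \<subseteq> G"
    unfolding A_def G_def prod_gale_rates_eq
    using hausdorff_measure_zero_imp_gale_success by blast
  \<comment> \<open>Since \<open>s\<close> is nonnegative, \<open>s < t\<close> makes
    \<open>t\<close> positive, as the construction of covers demands.\<close>
  have above: "t \<in> A" if "s \<in> G" "s < t" for s t
    using that gale_success_imp_hausdorff_measure_zero[of s _ F t]
    by (auto simp: A_def G_def prod_gale_rates_eq)
  have bdd: "bdd_below G" "bdd_below A"
    by (auto simp: A_def G_def prod_gale_rates_def intro!: bdd_belowI[of _ 0])
  have "Inf A = Inf G"
  proof (cases "G = {}")
    case True
    with sub show ?thesis by simp
  next
    case False
    then have ne: "A \<noteq> {}"
      using above by (metis empty_iff ex_in_conv gt_ex)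
    \<comment> \<open>An element of \<open>G\<close> itself need not be known to lie in
      \<open>A\<close>, but all larger reals do, and density closes the gap.\<close>
    have "Inf A \<le> Inf G"
    proof (rule cInf_greatest[OF False])
      fix s assume "s \<in> G"
      then have "Inf A \<le> t" if "s < t" for t
        using above[OF _ that] bdd(2) by (auto intro: cInf_lower)
      then show "Inf A \<le> s"
        by (rule dense_ge)
    qed
    with cInf_superset_mono[OF ne bdd(1) sub] show ?thesis by simp
  qed
  then show ?thesis
    by (simp add: hausdorff_dim_def A_def G_def)
qed

end
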